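(* Let $\mu:\mathcal{C}\to\mathbb{R}_0^+$ and $\nu_1,\nu_2:\mathcal{E}\to\mathbb{R}_0^+$ be set functions vanishing on the empty set, with $\nu_1\le\nu_2$ setwise, i.e. $\nu_1(E)\le\nu_2(E)$ for every $E\in\mathcal{E}$. Let $f:S\to\mathbb{R}_0^+$ be $\mu$-measurable. If $A\in\mathcal{C}$ is such that $f\in G_{RL}(\nu_1,\mu,A)\cap G_{RL}(\nu_2,\mu,A)$, then $$\int_A^{*} f\,d(\nu_1,\mu)\le\int_A^{*} f\,d(\nu_2,\mu).$$
   Context: $\mathbb{R}_0^+=[0,\infty)$. $S$ is a nonempty, at least countable set, $\mathcal{C}$ is a $\sigma$-algebra of subsets of $S$, and $\mathcal{E}$ is a $\sigma$-algebra of subsets of $\mathbb{R}_0^+$ with $\{0\}\in\mathcal{E}$. Set functions on $\mathcal{C}$ and $\mathcal{E}$ have values in $\mathbb{R}_0^+$, vanish on $\emptyset$, and are not assumed additive or monotone unless stated. Below, $\nu$ denotes any such set function on $\mathcal{E}$. Measurability: $f:S\to\mathbb{R}_0^+$ is $\mu$-measurable if it is $\mathcal{C}$-measurable, i.e. $E_f^\alpha:=\{s\in S: f(s)\ge\alpha\}\in\mathcal{C}$ for all $\alpha\ge 0$. Riemann-Lebesgue (RL) integral: for two countable partitions $P,P'$ of $\mathbb{R}_0^+$, $P'$ is finer than $P$ if every set of $P'$ is included in some set of $P$. A function $g:\mathbb{R}_0^+\to\mathbb{R}$ is $\nu$-RL integrable if there is $a\in\mathbb{R}$ such that for every $\varepsilon>0$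 there is a countable partition $\Pi_\varepsilon$ of $\mathbb{R}_0^+$ into sets of $\mathcal{E}$ such that for every countable partition $\Pi=(E_n)_n$ of $\mathbb{R}_0^+$ into sets of $\mathcal{E}$ finer than $\Pi_\varepsilon$: $g$ is bounded on every $E_n$ with $\nu(E_n)>0$, and for every choice of $s_n\in E_n$ the series $\sum_n g(s_n)\nu(E_n)$ converges absolutely and $|\sum_n g(s_n)\nu(E_n)-a|<\varepsilon$. Then $a$ is unique and is denoted $(RL)\int_{[0,\infty)}g\,d\nu$. Generalized decomposition integral: for a $\mu$-measurable $f:S\to\mathbb{R}_0^+$ and $A\in\mathcal{C}$ put $u_{f,\mu}^{A}(\alpha)=\mu(E_f^\alpha\cap A)$, $\alpha\ge 0$. $f$ is $(\nu,\mu)$-integrable on $A$ if $u_{f,\mu}^A$ is $\nu$-RL integrable on $\mathbb{R}_0^+$, and then $\int_A^{*}f\,d(\nu,\mu):=(RL)\int_{[0,\infty)}u_{f,\mu}^A\,d\nu$. $G_{RL}(\nu,\mu,A)$ is the set of all $\mu$-measurable $f:S\to\mathbb{R}_0^+$ that are $(\nu,\mu)$-integrable on $A$ (with finite integral). *)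

theory Defs
  imports "HOL-Analysis.Analysis"
begin

text \<open>
  The half-line is \<open>{0..} :: real set\<close>. Functions and set functions are total in HOL; only their
  values on the indicated carrier (respectively on members of the \<open>\<sigma>\<close>-algebra) matter.
\<close>

definition nonneg_set_fun :: "'a set set \<Rightarrow> ('a set \<Rightarrow> real) \<Rightarrow> bool" where
  "nonneg_set_fun M m \<longleftrightarrow> m \<in> M \<rightarrow> {0..} \<and> m {} = 0"

definition upper_level :: "'a set \<Rightarrow> ('a \<Rightarrow> real) \<Rightarrow> real \<Rightarrow> 'a set" where
  "upper_level S f \<alpha> = {s \<in> S. f s \<ge> \<alpha>}"

text \<open>Measurability of a nonnegative function; it depends on the domain of the set function only.\<close>

definition level_measurable :: "'a set \<Rightarrow> 'a set set \<Rightarrow> ('a \<Rightarrow> real) \<Rightarrow> bool" where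
  "level_measurable S C f \<longleftrightarrow> f \<in> S \<rightarrow> {0..} \<and> (\<forall>\<alpha>\<ge>0. upper_level S f \<alpha> \<in> C)"

text \<open>
  A countable partition is a finite or countably infinite set of nonempty, pairwise disjoint
  sets of the \<open>\<sigma>\<close>-algebra covering the half-line. Nonemptiness (part of \<open>partition_on\<close>) makes the
  choice of points below always possible.
\<close>

definition countable_partition :: "real set set \<Rightarrow> real set set \<Rightarrow> bool" where
  "countable_partition E P \<longleftrightarrow> partition_on {0..} P \<and> countable P \<and> P \<subseteq> E"

text \<open>
  The series over a partition is indexed by its members; as absolute convergence is demanded,
  this agrees with the series for any enumeration of the partition.
\<close>

definition has_RL_integral ::
    "real set set \<Rightarrow> (real set \<Rightarrow> real) \<Rightarrow> (real \<Rightarrow> real) \<Rightarrow> real \<Rightarrow> bool" where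
  "has_RL_integral E \<nu> g a \<longleftrightarrow>
     (\<forall>\<epsilon>>0. \<exists>P0. countable_partition E P0 \<and>
        (\<forall>P. countable_partition E P \<and> refines {0..} P P0 \<longrightarrow>
           (\<forall>X\<in>P. \<nu> X > 0 \<longrightarrow> bounded (g ` X)) \<and>
           (\<forall>s. (\<forall>X\<in>P. s X \<in> X) \<longrightarrow>
              (\<lambda>X. \<bar>g (s X) * \<nu> X\<bar>) summable_on P \<and>
              \<bar>(\<Sum>\<^sub>\<infinity>X\<in>P. g (s X) * \<nu> X) - a\<bar> < \<epsilon>)))"

definition RL_integrable :: "real set set \<Rightarrow> (real set \<Rightarrow> real) \<Rightarrow> (real \<Rightarrow> real) \<Rightarrow> bool" where
  "RL_integrable E \<nu> g \<longleftrightarrow> (\<exists>a. has_RL_integral E \<nu> g a)"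

definition RL_integral :: "real set set \<Rightarrow> (real set \<Rightarrow> real) \<Rightarrow> (real \<Rightarrow> real) \<Rightarrow> real" where
  "RL_integral E \<nu> g = (THE a. has_RL_integral E \<nu> g a)"

definition survival_fun ::
    "'a set \<Rightarrow> ('a set \<Rightarrow> real) \<Rightarrow> 'a set \<Rightarrow> ('a \<Rightarrow> real) \<Rightarrow> real \<Rightarrow> real" where
  "survival_fun S \<mu> A f \<alpha> = \<mu> (upper_level S f \<alpha> \<inter> A)"

definition G_RL :: "'a set \<Rightarrow> 'a set set \<Rightarrow> real set set \<Rightarrow>
    (real set \<Rightarrow> real) \<Rightarrow> ('a set \<Rightarrow> real) \<Rightarrow> 'a set \<Rightarrow> ('a \<Rightarrow> real) set" where
  "G_RL S C E \<nu> \<mu> A = {f. level_measurable S C f \<and> RL_integrable E \<nu> (survival_fun S \<mu> A f)}"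

definition decomp_integral :: "'a set \<Rightarrow> real set set \<Rightarrow>
    (real set \<Rightarrow> real) \<Rightarrow> ('a set \<Rightarrow> real) \<Rightarrow> 'a set \<Rightarrow> ('a \<Rightarrow> real) \<Rightarrow> real" where
  "decomp_integral S E \<nu> \<mu> A f = RL_integral E \<nu> (survival_fun S \<mu> A f)"

end

theory Submission
  imports Defs
begin

text \<open>
  On a common refinement of the partitions that witness two RL integrals within \<open>\<epsilon>\<close>, the
  Riemann sums for a single choice of points are comparable term by term, so the integrals
  compare up to \<open>2\<epsilon>\<close>. Comparing products \<open>g x * \<nu> X\<close> rather than set functions makes
  uniqueness of the integral an instance of monotonicity.
\<close>

text \<open>The witness consists of the nonempty pairwise intersections of members of
  \<open>P\<close> and \<open>Q\<close>. Closure of \<open>E\<close> under intersection keeps them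
  admissible, and they are countable because they are indexed by pairs in
  \<open>P \<times> Q\<close>.\<close>

lemma countable_partition_common_refinement:
  assumes "\<And>X Y. X \<in> E \<Longrightarrow> Y \<in> E \<Longrightarrow> X \<inter> Y \<in> E"
    and P: "countable_partition E P" and Q: "countable_partition E Q"
  obtains R where "countable_partition E R" "refines {0..} R P" "refines {0..} R Q"
proof
  let ?R = "common_refinement {P, Q}"
  have part: "\<And>T. T \<in> {P, Q} \<Longrightarrow> partition_on {0..} T"
    using P Q by (auto simp: countable_partition_def)
  \<comment> \<open>Only an inclusion, since \<open>common_refinement\<close> discards empty
    intersections; it suffices both for countability and for membership in \<open>E\<close>.\<close>
  have sub: "?R \<subseteq> (\<lambda>(X, Y). X \<inter> Y) ` (P \<times> Q)"
    by (auto simp: common_refinement)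
  have "countable ((\<lambda>(X, Y). X \<inter> Y) ` (P \<times> Q))"
    using P Q by (auto simp: countable_partition_def)
  then have "countable ?R"
    using sub countable_subset by blast
  moreover have "?R \<subseteq> E"
    using sub P Q by (force simp: countable_partition_def intro: assms(1))
  ultimately show "countable_partition E ?R"
    using partition_on_common_refinement[of "{P, Q}" "{0..}"] part
    by (auto simp: countable_partition_def)
  show "refines {0..} ?R P" "refines {0..} ?R Q"
    using part by (auto intro!: refines_common_refinement)
qed

lemma has_RL_integralE:
  assumes "has_RL_integral E \<nu> g a" "\<epsilon> > 0"
  obtains P where "countable_partition E P"
    "\<forall>R s. countable_partition E R \<and> refines {0..} R P \<and> (\<forall>X\<in>R. s X \<in> X) \<longrightarrow>
      (\<lambda>X. g (s X) * \<nu> X) summable_on R \<and> \<bar>(\<Sum>\<^sub>\<infinity>X\<in>R. g (s X) * \<nu> X) - a\<bar> < \<epsilon>"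
proof -
  obtain P where P: "countable_partition E P"
    and *: "\<forall>R. countable_partition E R \<and> refines {0..} R P \<longrightarrow>
      (\<forall>X\<in>R. \<nu> X > 0 \<longrightarrow> bounded (g ` X)) \<and>
      (\<forall>s. (\<forall>X\<in>R. s X \<in> X) \<longrightarrow>
        (\<lambda>X. \<bar>g (s X) * \<nu> X\<bar>) summable_on R \<and>
        \<bar>(\<Sum>\<^sub>\<infinity>X\<in>R. g (s X) * \<nu> X) - a\<bar> < \<epsilon>)"
    using assms(1)[unfolded has_RL_integral_def, rule_format, OF assms(2)]
    by (elim exE conjE) (rule that)
  show thesis
  proof (rule that[OF P], intro allI impI)
    fix R s assume "countable_partition E R \<and> refines {0..} R P \<and> (\<forall>X\<in>R. s X \<in> X)"
    then have R: "countable_partition E R" "refines {0..} R P" and s: "\<forall>X\<in>R. s X \<in> X"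
      by blast+
    have "(\<lambda>X. \<bar>g (s X) * \<nu> X\<bar>) summable_on R \<and>
        \<bar>(\<Sum>\<^sub>\<infinity>X\<in>R. g (s X) * \<nu> X) - a\<bar> < \<epsilon>"
      by (rule mp[OF spec[OF conjunct2[OF mp[OF spec[OF *] conjI[OF R]]]] s])
    then show "(\<lambda>X. g (s X) * \<nu> X) summable_on R \<and>
        \<bar>(\<Sum>\<^sub>\<infinity>X\<in>R. g (s X) * \<nu> X) - a\<bar> < \<epsilon>"
      unfolding summable_on_iff_abs_summable_on_real[of "\<lambda>X. g (s X) * \<nu> X"] real_norm_def .
  qed
qed

lemma has_RL_integral_mono:
  assumes Int: "\<And>X Y. X \<in> E \<Longrightarrow> Y \<in> E \<Longrightarrow> X \<inter> Y \<in> E"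
    and g: "has_RL_integral E \<nu> g a" and h: "has_RL_integral E \<nu>' h b"
    and le: "\<And>X x. X \<in> E \<Longrightarrow> x \<in> X \<Longrightarrow> x \<ge> 0 \<Longrightarrow> g x * \<nu> X \<le> h x * \<nu>' X"
  shows "a \<le> b"
proof (rule field_le_epsilon)
  fix e :: real assume "e > 0"
  \<comment> \<open>Each integral is approximated within e / 2, so that the two errors together use
    up the slack in a \<le> b + e.\<close>
  then have e2: "e / 2 > 0" by simp
  obtain P where P: "countable_partition E P"
    and Pg: "\<forall>R s. countable_partition E R \<and> refines {0..} R P \<and> (\<forall>X\<in>R. s X \<in> X) \<longrightarrow>
      (\<lambda>X. g (s X) * \<nu> X) summable_on R \<and> \<bar>(\<Sum>\<^sub>\<infinity>X\<in>R. g (s X) * \<nu> X) - a\<bar> < e / 2"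
    by (rule has_RL_integralE[OF g e2])
  obtain Q where Q: "countable_partition E Q"
    and Qh: "\<forall>R s. countable_partition E R \<and> refines {0..} R Q \<and> (\<forall>X\<in>R. s X \<in> X) \<longrightarrow>
      (\<lambda>X. h (s X) * \<nu>' X) summable_on R \<and> \<bar>(\<Sum>\<^sub>\<infinity>X\<in>R. h (s X) * \<nu>' X) - b\<bar> < e / 2"
    by (rule has_RL_integralE[OF h e2])
  obtain R where R: "countable_partition E R" "refines {0..} R P" "refines {0..} R Q"
    using countable_partition_common_refinement[OF Int P Q] by blast
  have part: "partition_on {0..} R" and "R \<subseteq> E"
    using R(1) by (auto simp: countable_partition_def)
  \<comment> \<open>Any selection would do, but the same one must enter both sums; members of a
    partition are nonempty, so it is a legitimate choice of points.\<close>
  define s :: "real set \<Rightarrow> real" where "s X = (SOME x. x \<in> X)" for X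
  have s: "\<forall>X\<in>R. s X \<in> X"
    using partition_onD3[OF part] unfolding s_def by (metis some_in_eq)
  note sum_g = mp[OF spec[OF spec[OF Pg]] conjI[OF R(1) conjI[OF R(2) s]]]
  note sum_h = mp[OF spec[OF spec[OF Qh]] conjI[OF R(1) conjI[OF R(3) s]]]
  have "(\<Sum>\<^sub>\<infinity>X\<in>R. g (s X) * \<nu> X) \<le> (\<Sum>\<^sub>\<infinity>X\<in>R. h (s X) * \<nu>' X)"
  proof (rule infsum_mono)
    show "(\<lambda>X. g (s X) * \<nu> X) summable_on R"
      using sum_g ..
    show "(\<lambda>X. h (s X) * \<nu>' X) summable_on R"
      using sum_h ..
    show "g (s X) * \<nu> X \<le> h (s X) * \<nu>' X" if "X \<in> R" for X
      \<comment> \<open>Since \<open>R\<close> partitions the half-line, the chosen points are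
        nonnegative, as \<open>le\<close> demands.\<close>
      using that s \<open>R \<subseteq> E\<close> partition_onD1[OF part] by (intro le) auto
  qed
  then show "a \<le> b + e"
    using sum_g sum_h by linarith
qed

lemma RL_integral_eqI:
  assumes "\<And>X Y. X \<in> E \<Longrightarrow> Y \<in> E \<Longrightarrow> X \<inter> Y \<in> E" and "has_RL_integral E \<nu> g a"
  shows "RL_integral E \<nu> g = a"
  unfolding RL_integral_def
proof (rule the_equality)
  \<comment> \<open>With equal integrands and set functions the termwise comparison is reflexivity,
    so monotonicity applies in both directions.\<close>
  show "b = a" if "has_RL_integral E \<nu> g b" for b
    using has_RL_integral_mono[OF assms(1) assms(2) that]
      has_RL_integral_mono[OF assms(1) that assms(2)] by fastforce
qed fact

theorem theorem3p14:
  fixes S :: "'a set" and C :: "'a set set" and E :: "real set set"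
    and \<mu> :: "'a set \<Rightarrow> real" and \<nu>1 \<nu>2 :: "real set \<Rightarrow> real"
    and f :: "'a \<Rightarrow> real" and A :: "'a set"
  assumes "S \<noteq> {}" and "infinite S"
    and "sigma_algebra S C"
    and "sigma_algebra {0..} E" and "{0} \<in> E"
    and "nonneg_set_fun C \<mu>"
    and "nonneg_set_fun E \<nu>1" and "nonneg_set_fun E \<nu>2"
    and "\<forall>X\<in>E. \<nu>1 X \<le> \<nu>2 X"
    and "level_measurable S C f"
    and "A \<in> C"
    and "f \<in> G_RL S C E \<nu>1 \<mu> A \<inter> G_RL S C E \<nu>2 \<mu> A"
  shows "decomp_integral S E \<nu>1 \<mu> A f \<le> decomp_integral S E \<nu>2 \<mu> A f"
proof -
  interpret C: sigma_algebra S C by fact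
  interpret E: sigma_algebra "{0..}" E by fact
  let ?u = "survival_fun S \<mu> A f"
  obtain a b where a: "has_RL_integral E \<nu>1 ?u a" and b: "has_RL_integral E \<nu>2 ?u b"
    using assms(12) by (auto simp: G_RL_def RL_integrable_def)
  \<comment> \<open>Multiplying \<nu>1 X \<le> \<nu>2 X by the integrand preserves the inequality
    only if the integrand is nonnegative. Here it is a value of \<mu> on a set of \<open>C\<close>,
    the intersection of a measurable level set with \<open>A\<close>.\<close>
  have "?u x \<ge> 0" if "x \<ge> 0" for x
    using that assms(6,10,11)
    by (auto simp: survival_fun_def level_measurable_def nonneg_set_fun_def Pi_iff)
  then have "a \<le> b"
    using assms(9) by (intro has_RL_integral_mono[OF E.Int a b] mult_left_mono) auto
  then show ?thesis
    using RL_integral_eqI[OF E.Int a] RL_integral_eqI[OF E.Int b]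
    by (simp add: decomp_integral_def)
qed

end
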